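(* Let $\mathbb{F}$ be a field with $|\mathbb{F}|>2$ and let $m\ge 5$ be an integer. Then there is a full-rank aperiodic projective tiling $(U,V)$ of $\mathbb{F}^{2m}$ with $|U|=|V|=|\mathbb{F}|^m$.
   Context: A pair $(U,V)$ of subsets of a vector space $\mathbb{S}$ is a tiling if every element of $\mathbb{S}$ is uniquely represented as $u+v$ with $u\in U$, $v\in V$. A subset $X$ is projective if $\mathbb{F}\cdot X=X$ (a union of $1$-dimensional subspaces); the tiling is projective if both $U$ and $V$ are projective. A subset is full-rank if its affine span is the whole space; a tiling is full-rank if both $U$ and $V$ are full-rank. A period of a set $X$ is a vector $w$ with $X+w=X$; $X$ is aperiodic if its only period is $0$; a tiling is aperiodic if both $U$ and $V$ are aperiodic. *)

theory Defs
  imports "HOL-Analysis.Finite_Cartesian_Product" "HOL-Analysis.Cartesian_Space"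
    "HOL-Library.Equipollence" "HOL-Library.FuncSet"
begin

definition tiling :: "'s::ab_group_add set \<Rightarrow> 's set \<Rightarrow> bool" where
  "tiling U V \<longleftrightarrow> (\<forall>s. \<exists>!p. p \<in> U \<times> V \<and> s = fst p + snd p)"

definition projective :: "('a::field ^ 'n) set \<Rightarrow> bool" where
  "projective X \<longleftrightarrow> {c *s x | c x. x \<in> X} = X"

text \<open>The constant \<open>affine hull\<close> of the library is restricted to real vector spaces.\<close>

definition affine_span :: "('a::field ^ 'n) set \<Rightarrow> ('a ^ 'n) set" where
  "affine_span X = {\<Sum>x\<in>T. c x *s x | T c. finite T \<and> T \<subseteq> X \<and> sum c T = 1}"

definition full_rank :: "('a::field ^ 'n) set \<Rightarrow> bool" where
  "full_rank X \<longleftrightarrow> affine_span X = UNIV"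

definition period :: "'s::ab_group_add set \<Rightarrow> 's \<Rightarrow> bool" where
  "period X w \<longleftrightarrow> (\<lambda>x. x + w) ` X = X"

definition aperiodic :: "'s::ab_group_add set \<Rightarrow> bool" where
  "aperiodic X \<longleftrightarrow> (\<forall>w. period X w \<longrightarrow> w = 0)"

definition projective_tiling :: "('a::field ^ 'n) set \<Rightarrow> ('a ^ 'n) set \<Rightarrow> bool" where
  "projective_tiling U V \<longleftrightarrow> tiling U V \<and> projective U \<and> projective V"

definition full_rank_tiling :: "('a::field ^ 'n) set \<Rightarrow> ('a ^ 'n) set \<Rightarrow> bool" where
  "full_rank_tiling U V \<longleftrightarrow> tiling U V \<and> full_rank U \<and> full_rank V"

definition aperiodic_tiling :: "'s::ab_group_add set \<Rightarrow> 's set \<Rightarrow> bool" where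
  "aperiodic_tiling U V \<longleftrightarrow> tiling U V \<and> aperiodic U \<and> aperiodic V"

end

theory Submission
  imports Defs "HOL-Combinatorics.Cycles"
begin

text \<open>
  Write the coordinates of a vector as a pair of vectors \<open>x\<close>, \<open>y\<close> with \<open>m\<close> entries each, indexed
  by the integers modulo \<open>m\<close>. Take for \<open>U\<close> the graph \<open>y = f x\<close> and for \<open>V\<close> the graph \<open>x = g y\<close> of
  two homogeneous non-linear maps. The map \<open>f\<close> is local: \<open>f\<^sub>i\<close> is \<open>x\<^sub>i\<close> if \<open>x\<^sub>i\<^sub>-\<^sub>1 \<noteq> 0\<close> and \<open>0\<close>
  otherwise, so changing only \<open>x\<^sub>i\<close> affects only the components \<open>i\<close> and \<open>i + 1\<close> of \<open>f x\<close>.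
  The map \<open>g\<close> has at most one non-zero component: \<open>g\<^sub>i\<close> is \<open>y\<^sub>i\<^sub>-\<^sub>1\<close> if \<open>y\<^sub>i\<^sub>-\<^sub>2\<close> and \<open>y\<^sub>i\<^sub>-\<^sub>1\<close> are non-zero
  and all \<open>y\<^sub>j\<close> with \<open>j\<close> different from \<open>i - 2\<close>, \<open>i - 1\<close>, \<open>i\<close>, \<open>i + 1\<close> vanish, and \<open>0\<close> otherwise;
  for \<open>m \<ge> 5\<close> these conditions exclude one another. Since \<open>g\<^sub>i\<close> ignores \<open>y\<^sub>i\<close> and \<open>y\<^sub>i\<^sub>+\<^sub>1\<close>, moving \<open>x\<close>
  by a multiple of \<open>g y\<close> changes \<open>y = b - f x\<close> without changing \<open>g y\<close>. Hence the system
  \<open>x + g y = a\<close>, \<open>y + f x = b\<close> has the unique solution with \<open>g y = g (b - f a)\<close>.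

  Each component of \<open>f\<close> and of \<open>g\<close> is switched off by the vanishing of one coordinate and otherwise
  takes arbitrary values, which excludes periods of the graphs and makes the graphs span.
  Only the map \<open>i \<mapsto> i - 1\<close> enters the construction, and \<open>m \<ge> 5\<close> only says that it has no cycle
  of length less than five.
\<close>

section \<open>Projective sets and affine spans\<close>

lemma projectiveI:
  fixes X :: "('a::field ^ 'n) set"
  assumes "\<And>c x. x \<in> X \<Longrightarrow> c *s x \<in> X"
  shows "projective X"
proof -
  have "x \<in> {c *s x | c x. x \<in> X}" if "x \<in> X" for x
    using that by (intro CollectI exI[of _ 1] exI[of _ x]) simp
  then show ?thesis
    unfolding projective_def using assms by blast
qed

lemma affine_span_eq_span:
  fixes X :: "('a::field ^ 'n) set"
  assumes "0 \<in> X"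
  shows "affine_span X = vec.span X"
proof
  show "affine_span X \<subseteq> vec.span X"
    unfolding affine_span_def vec.span_explicit by blast
  show "vec.span X \<subseteq> affine_span X"
  proof
    fix z assume "z \<in> vec.span X"
    then obtain T c where T: "finite T" "T \<subseteq> X" and z: "z = (\<Sum>x\<in>T. c x *s x)"
      unfolding vec.span_explicit by blast
    define c' where "c' = c(0 := 1 - sum c (T - {0}))"
    let ?T = "insert 0 (T - {0})"
    have c'_off_0: "c' x = c x" if "x \<in> T - {0}" for x
      using that by (simp add: c'_def)
    have "z = (\<Sum>x\<in>T - {0}. c x *s x)"
      unfolding z by (rule sum.mono_neutral_right) (use T(1) in auto)
    also have "\<dots> = (\<Sum>x\<in>?T. c' x *s x)"
      using T(1) c'_off_0 by (simp add: sum.insert_remove)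
    finally have "z = (\<Sum>x\<in>?T. c' x *s x)" .
    moreover have "sum c' ?T = 1"
      using T(1) c'_off_0 by (simp add: sum.insert_remove) (simp add: c'_def)
    moreover have "finite ?T" "?T \<subseteq> X"
      using T assms by auto
    ultimately show "z \<in> affine_span X"
      unfolding affine_span_def by blast
  qed
qed

lemma full_rank_iff_span:
  fixes X :: "('a::field ^ 'n) set"
  assumes "0 \<in> X"
  shows "full_rank X \<longleftrightarrow> vec.span X = UNIV"
  by (simp add: full_rank_def affine_span_eq_span[OF assms])

lemma axis_zero [simp]: "axis i 0 = 0"
  by simp

lemma span_eq_UNIV_if_axes:
  fixes X :: "('a::field ^ 'n) set"
  assumes "\<And>i. axis i 1 \<in> X"
  shows "vec.span X = UNIV"
proof -
  have "cart_basis \<subseteq> X"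
    using assms by (auto simp: cart_basis_def)
  from vec.span_mono[OF this] show ?thesis
    by (simp add: top.extremum_unique)
qed

section \<open>Graphs in a direct decomposition\<close>

definition graph :: "('s \<Rightarrow> 'b) \<Rightarrow> ('s \<Rightarrow> 'c) \<Rightarrow> ('b \<Rightarrow> 'c) \<Rightarrow> 's set" where
  "graph \<pi> \<rho> f = {s. \<rho> s = f (\<pi> s)}"

locale direct_decomposition = \<pi>: additive \<pi> + \<rho>: additive \<rho>
  for \<pi> :: "'s::ab_group_add \<Rightarrow> 'b::ab_group_add" and \<rho> :: "'s \<Rightarrow> 'c::ab_group_add" +
  assumes ex1_components: "\<exists>!s. \<pi> s = x \<and> \<rho> s = y"
begin

lemma components_eqI: "\<pi> s = \<pi> t \<Longrightarrow> \<rho> s = \<rho> t \<Longrightarrow> s = t"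
  using ex1_components by metis

lemma obtain_components:
  obtains s where "\<pi> s = x" "\<rho> s = y"
  using ex1_components by metis

lemma tiling_graphs:
  assumes g_stable: "\<And>x x' y. x' \<in> {x + g y, x - g y} \<Longrightarrow> g (y + f x - f x') = g y"
  shows "tiling (graph \<pi> \<rho> f) (graph \<rho> \<pi> g)"
  unfolding tiling_def
proof
  fix s
  define t where "t = g (\<rho> s - f (\<pi> s))"
  obtain u where u: "\<pi> u = \<pi> s - t" "\<rho> u = f (\<pi> u)"
    by (metis obtain_components)
  have uniqueness: "u' = u" if "u' \<in> graph \<pi> \<rho> f" "v' \<in> graph \<rho> \<pi> g" "s = u' + v'" for u' v'
  proof (rule components_eqI)
    have u': "\<rho> u' = f (\<pi> u')" and v': "\<pi> v' = g (\<rho> v')"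
      using that by (simp_all add: graph_def)
    have "g (\<rho> v' + f (\<pi> u') - f (\<pi> s)) = g (\<rho> v')"
      by (rule g_stable) (simp add: that(3) \<pi>.add v')
    then have "t = \<pi> v'"
      by (simp add: t_def that(3) \<rho>.add u' v' add.commute)
    then show "\<pi> u' = \<pi> u"
      by (simp add: u(1) that(3) \<pi>.add)
    then show "\<rho> u' = \<rho> u"
      by (simp add: u(2) u')
  qed
  show "\<exists>!p. p \<in> graph \<pi> \<rho> f \<times> graph \<rho> \<pi> g \<and> s = fst p + snd p"
  proof (rule ex1I)
    have "g (\<rho> s - f (\<pi> s) + f (\<pi> s) - f (\<pi> u)) = t"
      unfolding t_def by (rule g_stable) (simp add: u t_def)
    with u show "(u, s - u) \<in> graph \<pi> \<rho> f \<times> graph \<rho> \<pi> g \<and> s = fst (u, s - u) + snd (u, s - u)"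
      by (simp add: graph_def \<pi>.diff \<rho>.diff)
  next
    fix p assume p: "p \<in> graph \<pi> \<rho> f \<times> graph \<rho> \<pi> g \<and> s = fst p + snd p"
    then have "fst p = u"
      using uniqueness by (auto simp: mem_Times_iff)
    with p show "p = (u, s - u)"
      by (auto simp: prod_eq_iff)
  qed
qed

lemma aperiodic_graph:
  assumes "\<And>w c. (\<And>x. f (x + w) = f x + c) \<Longrightarrow> w = 0"
  shows "aperiodic (graph \<pi> \<rho> f)"
  unfolding aperiodic_def
proof (intro allI impI)
  fix w assume w: "period (graph \<pi> \<rho> f) w"
  have f_translate: "f (x + \<pi> w) = f x + \<rho> w" for x
  proof -
    obtain s where s: "\<pi> s = x" "\<rho> s = f x"
      by (rule obtain_components)
    then have "s \<in> graph \<pi> \<rho> f"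
      by (simp add: graph_def)
    then have "s + w \<in> graph \<pi> \<rho> f"
      using w by (auto simp: period_def)
    then show ?thesis
      by (simp add: graph_def \<pi>.add \<rho>.add s)
  qed
  then have "\<pi> w = 0"
    by (rule assms)
  moreover from this have "\<rho> w = 0"
    using f_translate[of 0] by simp
  ultimately show "w = 0"
    by (intro components_eqI) (simp_all add: \<pi>.zero \<rho>.zero)
qed

lemma graph_eqpoll_UNIV: "graph \<pi> \<rho> f \<approx> (UNIV :: 'b set)"
proof -
  have "inj_on \<pi> (graph \<pi> \<rho> f)"
    by (rule inj_onI) (simp add: graph_def components_eqI)
  moreover have "\<exists>s\<in>graph \<pi> \<rho> f. x = \<pi> s" for x
    using ex1_components[of x "f x"] by (auto simp: graph_def)
  then have "\<pi> ` graph \<pi> \<rho> f = UNIV"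
    by (simp add: image_iff set_eq_iff)
  ultimately show ?thesis
    unfolding eqpoll_def bij_betw_def by blast
qed

end

locale linear_decomposition = direct_decomposition \<pi> \<rho>
  for \<pi> :: "'a::field ^ 'n \<Rightarrow> 'a ^ 'b" and \<rho> :: "'a ^ 'n \<Rightarrow> 'a ^ 'c" +
  assumes \<pi>_scale: "\<pi> (c *s s) = c *s \<pi> s"
    and \<rho>_scale: "\<rho> (c *s s) = c *s \<rho> s"
begin

lemma linear_decomposition_swap: "linear_decomposition \<rho> \<pi>"
  by unfold_locales (simp_all add: ex1_components conj_commute \<pi>_scale \<rho>_scale)

lemma linear_\<pi>: "Vector_Spaces.linear (*s) (*s) \<pi>"
  by unfold_locales (simp_all add: \<pi>.add \<pi>_scale)

lemma linear_\<rho>: "Vector_Spaces.linear (*s) (*s) \<rho>"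
  by unfold_locales (simp_all add: \<rho>.add \<rho>_scale)

lemma projective_graph:
  assumes "\<And>c x. f (c *s x) = c *s f x"
  shows "projective (graph \<pi> \<rho> f)"
  by (rule projectiveI) (simp add: graph_def \<pi>_scale \<rho>_scale assms)

lemma kernel_subset_subspace:
  assumes "vec.subspace S" and "vec.span (\<pi> ` (S \<inter> {s. \<rho> s = 0})) = UNIV"
  shows "{s. \<rho> s = 0} \<subseteq> S"
proof
  fix s assume "s \<in> {s. \<rho> s = 0}"
  have "vec.subspace (\<pi> ` (S \<inter> {s. \<rho> s = 0}))"
    using assms(1) linear_\<pi> linear_\<rho>
    by (intro vec.linear_subspace_image vec.subspace_inter vec.linear_subspace_kernel)
  then have "\<pi> s \<in> \<pi> ` (S \<inter> {s. \<rho> s = 0})"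
    using assms(2) by (simp add: vec.span_eq_iff[THEN iffD2])
  then obtain s' where "s' \<in> S" "\<rho> s' = 0" "\<pi> s' = \<pi> s"
    by auto
  with \<open>s \<in> {s. \<rho> s = 0}\<close> show "s \<in> S"
    using components_eqI[of s' s] by simp
qed

lemma kernel_\<rho>_subset_span_graph:
  assumes "vec.span {x. f x = 0} = UNIV"
  shows "{s. \<rho> s = 0} \<subseteq> vec.span (graph \<pi> \<rho> f)"
proof (rule kernel_subset_subspace)
  let ?X = "\<pi> ` (vec.span (graph \<pi> \<rho> f) \<inter> {s. \<rho> s = 0})"
  have "{x. f x = 0} \<subseteq> ?X"
  proof
    fix x assume "x \<in> {x. f x = 0}"
    moreover obtain s where "\<pi> s = x" "\<rho> s = 0"
      by (rule obtain_components)
    ultimately show "x \<in> ?X"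
      by (auto simp: graph_def intro!: vec.span_base image_eqI[of x \<pi> s])
  qed
  from vec.span_mono[OF this] show "vec.span ?X = UNIV"
    by (simp add: assms top.extremum_unique)
qed simp

lemma kernel_\<pi>_subset_span_graph:
  assumes "vec.span {x. f x = 0} = UNIV" and "vec.span (range f) = UNIV"
  shows "{s. \<pi> s = 0} \<subseteq> vec.span (graph \<pi> \<rho> f)"
proof (rule linear_decomposition.kernel_subset_subspace[OF linear_decomposition_swap])
  let ?S = "vec.span (graph \<pi> \<rho> f)"
  have "range f \<subseteq> \<rho> ` (?S \<inter> {s. \<pi> s = 0})"
  proof
    fix y assume "y \<in> range f"
    then obtain x where y: "y = f x"
      by blast
    obtain s where s: "\<pi> s = x" "\<rho> s = f x"
      by (rule obtain_components)
    obtain t where t: "\<pi> t = x" "\<rho> t = 0"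
      by (rule obtain_components)
    have "s \<in> ?S" "t \<in> ?S"
      using s t kernel_\<rho>_subset_span_graph[OF assms(1)]
      by (auto simp: graph_def intro: vec.span_base)
    then have "s - t \<in> ?S"
      by (rule vec.span_diff)
    then show "y \<in> \<rho> ` (?S \<inter> {s. \<pi> s = 0})"
      using s t y by (intro image_eqI[of _ _ "s - t"]) (simp_all add: \<pi>.diff \<rho>.diff)
  qed
  from vec.span_mono[OF this] show "vec.span (\<rho> ` (?S \<inter> {s. \<pi> s = 0})) = UNIV"
    by (simp add: assms(2) top.extremum_unique)
qed simp

lemma full_rank_graph:
  assumes "f 0 = 0" and "vec.span {x. f x = 0} = UNIV" and "vec.span (range f) = UNIV"
  shows "full_rank (graph \<pi> \<rho> f)"
proof -
  let ?S = "vec.span (graph \<pi> \<rho> f)"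
  have "s \<in> ?S" for s
  proof -
    obtain t where t: "\<pi> t = \<pi> s" "\<rho> t = 0"
      by (rule obtain_components)
    have "t \<in> ?S"
      using kernel_\<rho>_subset_span_graph[OF assms(2)] t(2) by blast
    moreover have "s - t \<in> ?S"
      using kernel_\<pi>_subset_span_graph[OF assms(2,3)] t(1) by (auto simp: \<pi>.diff)
    ultimately have "t + (s - t) \<in> ?S"
      by (rule vec.span_add)
    then show ?thesis
      by simp
  qed
  moreover have "0 \<in> graph \<pi> \<rho> f"
    by (simp add: graph_def \<pi>.zero \<rho>.zero assms(1))
  ultimately show ?thesis
    by (auto simp: full_rank_iff_span)
qed

end

lemma obtain_linear_decomposition:
  assumes "CARD('n::finite) = CARD('b::finite) + CARD('c::finite)"
  obtains \<pi> :: "'a::field ^ 'n \<Rightarrow> 'a ^ 'b" and \<rho> :: "'a ^ 'n \<Rightarrow> 'a ^ 'c"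
  where "linear_decomposition \<pi> \<rho>"
proof -
  have "CARD('b + 'c) = CARD('n)"
    using assms by simp
  then obtain e :: "'b + 'c \<Rightarrow> 'n" where e: "bij e"
    using finite_same_card_bij[OF finite_class.finite_UNIV finite_class.finite_UNIV] by blast
  define \<pi> :: "'a ^ 'n \<Rightarrow> 'a ^ 'b" where "\<pi> s = (\<chi> i. s $ e (Inl i))" for s
  define \<rho> :: "'a ^ 'n \<Rightarrow> 'a ^ 'c" where "\<rho> s = (\<chi> i. s $ e (Inr i))" for s
  have "\<exists>!s. \<pi> s = x \<and> \<rho> s = y" for x y
  proof (rule ex1I)
    let ?join = "\<chi> k. case_sum (($) x) (($) y) (inv e k)"
    show "\<pi> ?join = x \<and> \<rho> ?join = y"
      by (simp add: \<pi>_def \<rho>_def inv_f_f[OF bij_is_inj[OF e]] vec_eq_iff)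
    fix s assume s: "\<pi> s = x \<and> \<rho> s = y"
    have "s $ e i = case_sum (($) x) (($) y) i" for i
      using s by (auto simp: \<pi>_def \<rho>_def split: sum.split)
    then have "s $ k = case_sum (($) x) (($) y) (inv e k)" for k
      using surj_f_inv_f[OF bij_is_surj[OF e], of k] by metis
    then show "s = ?join"
      by (simp add: vec_eq_iff)
  qed
  then have "linear_decomposition \<pi> \<rho>"
    by unfold_locales (simp_all add: \<pi>_def \<rho>_def vec_eq_iff)
  then show ?thesis
    by (rule that)
qed

section \<open>Switching maps\<close>

locale switching_map =
  fixes F :: "'a::field ^ 'b::finite \<Rightarrow> 'a ^ 'c::finite" and switch input :: "'c \<Rightarrow> 'b"
  assumes surj_switch: "surj switch"
    and input_neq_switch: "input i \<noteq> switch i"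
    and switched_off: "x $ switch i = 0 \<Longrightarrow> F x $ i = 0"
    and switched_on: "s \<noteq> 0 \<Longrightarrow> F (axis (switch i) s + axis (input i) t) = axis i t"
begin

lemma map_zero: "F 0 = 0"
  by (simp add: vec_eq_iff switched_off)

lemma span_zeros: "vec.span {x. F x = 0} = UNIV"
proof (rule span_eq_UNIV_if_axes)
  fix l
  obtain i where "l = switch i"
    using surj_switch by blast
  then show "axis l 1 \<in> {x. F x = 0}"
    using switched_on[of 1 i 0] by simp
qed

lemma span_range: "vec.span (range F) = UNIV"
proof (rule span_eq_UNIV_if_axes)
  show "axis i 1 \<in> range F" for i
    using switched_on[of 1 i 1] by (metis one_neq_zero rangeI)
qed

lemma translation_eq_zero:
  assumes "\<And>x. F (x + w) = F x + c"
  shows "w = 0"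
proof (rule ccontr)
  assume "w \<noteq> 0"
  then obtain i where w: "w $ switch i \<noteq> 0"
    using surj_switch by (metis surjD vec_eq_iff zero_index)
  have "t + c $ i = 0" for t
  proof -
    define x where "x = axis (switch i) (- w $ switch i) + axis (input i) t"
    have "F (x + w) $ i = 0"
      using input_neq_switch[of i] by (intro switched_off) (auto simp: x_def axis_def)
    moreover have "F x $ i = t"
      using w by (simp add: x_def switched_on)
    ultimately show ?thesis
      using assms by (metis vector_add_component)
  qed
  from this[of 0] this[of 1] show False
    by simp
qed

end

context linear_decomposition
begin

lemma full_rank_graph_switching_map:
  assumes "switching_map F switch input"
  shows "full_rank (graph \<pi> \<rho> F)"
proof -
  interpret switching_map F switch input by fact
  show ?thesis
    by (intro full_rank_graph map_zero span_zeros span_range)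
qed

lemma aperiodic_graph_switching_map:
  assumes "switching_map F switch input"
  shows "aperiodic (graph \<pi> \<rho> F)"
proof -
  interpret switching_map F switch input by fact
  show ?thesis
    by (intro aperiodic_graph translation_eq_zero)
qed

end

section \<open>The gate map and the shift map\<close>

locale no_short_cycles =
  fixes prev :: "'b::finite \<Rightarrow> 'b"
  assumes inj_prev: "inj prev"
    and funpow_prev_neq: "0 < d \<Longrightarrow> d < 5 \<Longrightarrow> (prev ^^ d) i \<noteq> i"
begin

definition gate_map :: "'a::zero ^ 'b \<Rightarrow> 'a ^ 'b" where
  "gate_map x = (\<chi> i. if x $ prev i = 0 then 0 else x $ i)"

definition active :: "'a::zero ^ 'b \<Rightarrow> 'b \<Rightarrow> bool" where
  "active y i \<longleftrightarrow> y $ prev (prev i) \<noteq> 0 \<and> y $ prev i \<noteq> 0 \<and>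
    (\<forall>j. y $ j \<noteq> 0 \<longrightarrow> j \<in> {prev (prev i), prev i, i} \<or> prev j = i)"

definition shift_map :: "'a::zero ^ 'b \<Rightarrow> 'a ^ 'b" where
  "shift_map y = (\<chi> i. if active y i then y $ prev i else 0)"

lemma prev_eq_iff [simp]: "prev i = prev j \<longleftrightarrow> i = j"
  using inj_prev by (rule inj_eq)

lemma surj_prev: "surj prev"
  using inj_prev by (simp add: finite_UNIV_inj_surj)

lemma prev_neq [simp]:
  "prev i \<noteq> i" "prev (prev i) \<noteq> i" "prev (prev (prev i)) \<noteq> i" "prev (prev (prev (prev i))) \<noteq> i"
  using funpow_prev_neq[of 1 i] funpow_prev_neq[of 2 i] funpow_prev_neq[of 3 i]
    funpow_prev_neq[of 4 i]
  by (simp_all add: numeral_eq_Suc)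

lemmas neq_prev [simp] = prev_neq[symmetric]

lemma active_imp_near:
  assumes "active y i" "active y k"
  shows "k \<in> {i, prev i, prev (prev i)}"
proof -
  have "prev (prev i) \<in> {prev (prev k), prev k, k} \<or> prev (prev (prev i)) = k"
    "prev i \<in> {prev (prev k), prev k, k} \<or> prev (prev i) = k"
    using assms unfolding active_def by blast+
  then show ?thesis
    by auto
qed

lemma active_unique:
  assumes "active y i" "active y k"
  shows "i = k"
  using active_imp_near[OF assms] active_imp_near[OF assms(2,1)] by auto

lemma shift_map_active: "active y k \<Longrightarrow> shift_map y = axis k (y $ prev k)"
  using active_unique by (auto simp: shift_map_def vec_eq_iff axis_def)

lemma shift_map_eqI_active:
  assumes active: "active y k"
    and agree: "\<And>j. j \<noteq> k \<Longrightarrow> prev j \<noteq> k \<Longrightarrow> y' $ j = y $ j"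
  shows "shift_map y' = shift_map y"
proof -
  have "y' $ prev k = y $ prev k" "y' $ prev (prev k) = y $ prev (prev k)"
    by (rule agree; simp)+
  moreover from this have "active y' k"
    using active agree unfolding active_def by (metis insert_iff)
  ultimately show ?thesis
    using active by (simp add: shift_map_active)
qed

lemma gate_map_local:
  assumes "\<And>j. j \<noteq> k \<Longrightarrow> x' $ j = x $ j" and "j \<noteq> k" "prev j \<noteq> k"
  shows "gate_map x' $ j = gate_map x $ j"
  using assms by (simp add: gate_map_def)

lemma shift_map_stable:
  fixes x x' y :: "'a::ab_group_add ^ 'b"
  assumes "\<And>i. shift_map y $ i = 0 \<Longrightarrow> x' $ i = x $ i"
  shows "shift_map (y + gate_map x - gate_map x') = shift_map y"
proof (cases "\<exists>k. active y k")
  case True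
  then obtain k where k: "active y k"
    by blast
  then have "x' $ j = x $ j" if "j \<noteq> k" for j
    using that assms by (simp add: shift_map_active axis_def)
  then show ?thesis
    using gate_map_local[of k x' x] by (intro shift_map_eqI_active[OF k]) simp
next
  case False
  then have "x' = x"
    using assms by (simp add: shift_map_def vec_eq_iff)
  then show ?thesis
    by simp
qed

lemma tiling_gate_shift:
  assumes "direct_decomposition \<pi> \<rho>"
  shows "tiling (graph \<pi> \<rho> gate_map) (graph \<rho> \<pi> shift_map)"
  using assms by (intro direct_decomposition.tiling_graphs shift_map_stable) auto

lemma gate_map_scale: "gate_map (c *s x) = c *s gate_map x" for c :: "'a::field"
  by (simp add: gate_map_def vec_eq_iff)

lemma shift_map_scale: "shift_map (c *s y) = c *s shift_map y" for c :: "'a::field"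
proof (cases "c = 0")
  case False
  then have "active (c *s y) i \<longleftrightarrow> active y i" for i
    by (simp add: active_def)
  then show ?thesis
    by (simp add: shift_map_def vec_eq_iff)
qed (simp add: shift_map_def vec_eq_iff active_def)

lemma switching_map_gate_map: "switching_map (gate_map :: 'a::field ^ 'b \<Rightarrow> _) prev id"
proof
  show "surj prev"
    by (rule surj_prev)
  show "gate_map (axis (prev i) s + axis (id i) t) = axis i t" if "s \<noteq> 0" for i and s t :: 'a
    using that by (auto simp: gate_map_def vec_eq_iff axis_def)
qed (simp_all add: gate_map_def)

lemma switching_map_shift_map:
  "switching_map (shift_map :: 'a::field ^ 'b \<Rightarrow> _) (\<lambda>i. prev (prev i)) prev"
proof
  show "surj (\<lambda>i. prev (prev i))"
    using comp_surj[OF surj_prev surj_prev] by (simp add: comp_def)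
  show "shift_map (axis (prev (prev i)) s + axis (prev i) t) = axis i t"
    if "s \<noteq> 0" for i and s t :: 'a
  proof (cases "t = 0")
    case True
    then have "\<not> active (axis (prev (prev i)) s + axis (prev i) t) k" for k
      by (auto simp: active_def axis_def)
    with True show ?thesis
      by (simp add: shift_map_def vec_eq_iff)
  next
    case False
    with that have "active (axis (prev (prev i)) s + axis (prev i) t) i"
      by (auto simp: active_def axis_def)
    then show ?thesis
      by (simp add: shift_map_active axis_def)
  qed
qed (simp_all add: shift_map_def active_def)

end

section \<open>Index types\<close>

lemma obtain_no_short_cycles:
  assumes "CARD('b::finite) \<ge> 5"
  obtains prev :: "'b::finite \<Rightarrow> 'b" where "no_short_cycles prev"
proof -
  obtain xs :: "'b list" where xs: "set xs = UNIV" "distinct xs"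
    using finite_distinct_list[of "UNIV :: 'b set"] by auto
  have length: "length xs = CARD('b)"
    using distinct_card[OF xs(2)] xs(1) by simp
  have "no_short_cycles (cycle_of_list xs)"
  proof
    show "inj (cycle_of_list xs)"
      using cycle_permutes[of xs] by (rule permutes_inj)
    fix d :: nat and i
    assume d: "0 < d" "d < 5"
    obtain k where k: "k < length xs" "i = xs ! k"
      using xs(1) by (metis UNIV_I in_set_conv_nth)
    have "(cycle_of_list xs ^^ d) i = rotate d xs ! k"
      using k cyclic_rotation[OF xs(2), of d] by (metis nth_map)
    also have "\<dots> = xs ! ((d + k) mod length xs)"
      using k(1) by (rule nth_rotate)
    also have "\<dots> \<noteq> xs ! k"
      using k(1) d length assms
      by (cases "d + k < length xs") (simp_all add: nth_eq_iff_index_eq[OF xs(2)] le_mod_geq)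
    finally show "(cycle_of_list xs ^^ d) i \<noteq> i"
      by (simp add: k(2))
  qed
  then show ?thesis
    by (rule that)
qed

text \<open>
  No type with \<open>m\<close> elements is available for a natural number \<open>m\<close>; if \<open>CARD('n) = 2 * m\<close>, then
  \<open>'n half\<close> is one. Rounding up keeps it inhabited when \<open>CARD('n) = 1\<close>.
\<close>

typedef 'n half = "{..<(CARD('n::finite) + 1) div 2}"
  by (rule exI[of _ 0]) (simp add: Suc_leI)

instance half :: (finite) finite
proof
  show "finite (UNIV :: 'a half set)"
    unfolding type_definition.univ[OF type_definition_half] by simp
qed

lemma card_half: "CARD('n::finite half) = (CARD('n) + 1) div 2"
  unfolding type_definition.card[OF type_definition_half] by simp

lemma vec_eqpoll_PiE:
  assumes "A \<approx> (UNIV :: 'b::finite set)"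
  shows "(UNIV :: ('a ^ 'b) set) \<approx> (A \<rightarrow>\<^sub>E (UNIV :: 'a set))"
proof -
  obtain h where h: "bij_betw h A (UNIV :: 'b set)"
    using assms unfolding eqpoll_def by blast
  have "bij_betw (\<lambda>x :: 'a ^ 'b. \<lambda>k\<in>A. x $ h k) UNIV (A \<rightarrow>\<^sub>E UNIV)"
  proof (rule bij_betwI[where g = "\<lambda>\<phi>. \<chi> i. \<phi> (inv_into A h i)"])
    show "(\<chi> i. (\<lambda>k\<in>A. x $ h k) (inv_into A h i)) = x" for x :: "'a ^ 'b"
      using h by (simp add: bij_betw_def inv_into_into f_inv_into_f)
    show "(\<lambda>k\<in>A. (\<chi> i. \<phi> (inv_into A h i)) $ h k) = \<phi>" if "\<phi> \<in> A \<rightarrow>\<^sub>E UNIV" for \<phi> :: "_ \<Rightarrow> 'a"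
      using that h by (auto simp: bij_betw_def PiE_def intro!: extensionalityI[of _ A])
  qed auto
  then show ?thesis
    unfolding eqpoll_def by blast
qed

theorem theorem2:
  fixes m :: nat
  assumes "{..<2::nat} \<prec> (UNIV :: 'a::field set)"
    and "m \<ge> 5"
    and "CARD('n::finite) = 2 * m"
  shows "\<exists>U V :: ('a ^ 'n) set.
    full_rank_tiling U V \<and> aperiodic_tiling U V \<and> projective_tiling U V \<and>
    U \<approx> ({..<m} \<rightarrow>\<^sub>E (UNIV :: 'a set)) \<and>
    V \<approx> ({..<m} \<rightarrow>\<^sub>E (UNIV :: 'a set))"
proof -
  have card: "CARD('n half) = m"
    by (simp add: card_half assms(3))
  then have index_eqpoll: "{..<m} \<approx> (UNIV :: 'n half set)"
    by (simp add: eqpoll_iff_card)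
  obtain prev :: "'n half \<Rightarrow> 'n half" where "no_short_cycles prev"
    using obtain_no_short_cycles card assms(2) by blast
  then interpret no_short_cycles prev .
  obtain \<pi> \<rho> :: "'a ^ 'n \<Rightarrow> 'a ^ 'n half" where "linear_decomposition \<pi> \<rho>"
    using obtain_linear_decomposition card assms(3) by (metis mult_2)
  then interpret linear_decomposition \<pi> \<rho> .
  interpret swap: linear_decomposition \<rho> \<pi>
    by (rule linear_decomposition_swap)
  let ?U = "graph \<pi> \<rho> gate_map" and ?V = "graph \<rho> \<pi> shift_map"
  have "tiling ?U ?V"
    by (rule tiling_gate_shift) (rule direct_decomposition_axioms)
  moreover have "full_rank ?U" "full_rank ?V" "aperiodic ?U" "aperiodic ?V"
    using switching_map_gate_map switching_map_shift_map
    by (blast intro: full_rank_graph_switching_map swap.full_rank_graph_switching_map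
        aperiodic_graph_switching_map swap.aperiodic_graph_switching_map)+
  moreover have "projective ?U" "projective ?V"
    by (intro projective_graph swap.projective_graph gate_map_scale shift_map_scale)+
  moreover have "?U \<approx> ({..<m} \<rightarrow>\<^sub>E (UNIV :: 'a set))" "?V \<approx> ({..<m} \<rightarrow>\<^sub>E (UNIV :: 'a set))"
    using vec_eqpoll_PiE[OF index_eqpoll]
    by (blast intro: eqpoll_trans graph_eqpoll_UNIV swap.graph_eqpoll_UNIV)+
  ultimately show ?thesis
    unfolding full_rank_tiling_def aperiodic_tiling_def projective_tiling_def by blast
qed

end
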